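(* Let $R$ be a discrete valuation ring with uniformiser $\varpi$ and fraction field $K$, and let $n\ge 1$ be an integer. Put $$T^{-}=\{\mathrm{diag}(\varpi^{f_1},\ldots,\varpi^{f_n}) : f_1,\ldots,f_n\in\mathbb{Z},\ f_1\ge f_2\ge\cdots\ge f_n\}\subset \mathrm{GL}_n(K).$$ Then $\mathrm{GL}_n(K)$ decomposes as a disjoint union of double cosets $$\mathrm{GL}_n(K)=\bigsqcup_{t\in T^{-}}\mathrm{GL}_n(R)\cdot t\cdot \mathrm{GL}_n(R).$$
   Context: $\mathrm{GL}_n(R)$ is regarded as a subgroup of $\mathrm{GL}_n(K)$ via the inclusion $R\subset K$. The disjoint union means that every element of $\mathrm{GL}_n(K)$ lies in the double coset of some $t\in T^-$, and that the double cosets of distinct elements of $T^-$ are disjoint. $K$ is not assumed complete. *)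

theory Defs
  imports
    "HOL-Algebra.Algebraic_Closure_Type"
    "HOL-Library.Disjoint_Sets"
    "HOL-Computational_Algebra.Polynomial_Factorial"
    "Jordan_Normal_Form.Matrix"
begin

text \<open>A discrete valuation ring is a local principal ideal domain that is not a field.\<close>

locale discrete_valuation_ring = principal_domain R for R (structure) +
  assumes unique_maximalideal: "\<exists>!M. maximalideal M R"
    and not_field: "\<not> field R"

definition uniformiser :: "('a, 'b) ring_scheme \<Rightarrow> 'a \<Rightarrow> bool" where
  "uniformiser R p \<longleftrightarrow> p \<in> carrier R \<and> maximalideal (PIdl\<^bsub>R\<^esub> p) R"

text \<open>
  The inverse demanded by \<^const>\<open>invertible_mat\<close> has entries in the same type, so over a
  ring that is not a field this is invertibility over that ring.
\<close>

definition GL :: "nat \<Rightarrow> 'a::comm_ring_1 mat set" where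
  "GL n = {A \<in> carrier_mat n n. invertible_mat A}"

text \<open>The image of \<open>GL\<^sub>n(R)\<close> in \<open>GL\<^sub>n(K)\<close>, where \<open>K\<close> is the fraction field of \<open>R\<close>.\<close>

definition GL_integral :: "nat \<Rightarrow> 'a::idom fract mat set" where
  "GL_integral n = map_mat to_fract ` (GL n :: 'a mat set)"

text \<open>Matrix indices start at \<open>0\<close>, so \<open>f i\<close> is the exponent \<open>f\<^sub>i\<^sub>+\<^sub>1\<close>.\<close>

definition T_minus :: "nat \<Rightarrow> 'a::idom \<Rightarrow> 'a fract mat set" where
  "T_minus n p =
     {mat_diag n (\<lambda>i. to_fract p powi f i) | f :: nat \<Rightarrow> int.
        \<forall>i j. i \<le> j \<and> j < n \<longrightarrow> f i \<ge> f j}"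

definition double_coset :: "'a::semiring_0 mat set \<Rightarrow> 'a mat \<Rightarrow> 'a mat set" where
  "double_coset H t = {g * t * h | g h. g \<in> H \<and> h \<in> H}"

end

theory Submission
  imports Defs "Jordan_Normal_Form.Determinant"
begin

text \<open>
  Existence is the Smith normal form: after clearing denominators, divide a matrix by the largest
  power of the uniformiser dividing all of its entries. Some entry is then a unit; move it to the
  bottom right corner, use it to clear its row and column, and recurse on the remaining block.
  Restoring the power makes the exponents decrease automatically.

  For uniqueness, suppose \<open>g D = D' h\<close> with \<open>D\<close>, \<open>D'\<close> in \<open>T\<^sup>-\<close> and \<open>g\<close>, \<open>h\<close> integral invertible. If
  the \<open>k\<close>-th exponent of \<open>D'\<close> exceeded that of \<open>D\<close>, then the entries of \<open>g\<close> in a block with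
  \<open>k + 1\<close> rows and \<open>n - k\<close> columns would all be divisible by the uniformiser, and hence so would
  \<open>det g\<close>, which is a unit.
\<close>

section \<open>Discrete valuation rings\<close>

lemma PIdl_ring_of_type_algebra:
  fixes p :: "'a::idom"
  shows "PIdl\<^bsub>ring_of_type_algebra\<^esub> p = {x. p dvd x}"
  by (auto simp: cgenideal_def ring_of_type_algebra_def dvd_def mult.commute)

lemma Units_ring_of_type_algebra:
  "Units (ring_of_type_algebra :: 'a::idom ring) = {x. x dvd 1}"
  by (auto simp: Units_def ring_of_type_algebra_def dvd_def mult.commute)

text \<open>The interface between ring theory and matrices: the facts about a uniformiser on which
  the matrix arguments rest, in terms of divisibility.\<close>

locale dvr_uniformiser =
  fixes \<pi> :: "'a::idom"
  assumes uniformiser_nonzero: "\<pi> \<noteq> 0"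
    and uniformiser_nonunit: "\<not> \<pi> dvd 1"
    and uniformiser_dvd_nonunit: "\<not> x dvd 1 \<Longrightarrow> \<pi> dvd x"
    and unit_times_power: "x \<noteq> 0 \<Longrightarrow> \<exists>u k. u dvd 1 \<and> x = u * \<pi> ^ k"

text \<open>Every nonzero nonunit has an irreducible divisor; this generates the unique maximal
  ideal, so \<pi> divides the nonunit too. Valuations are finite because the ideals generated by the
  powers of \<pi> intersect in zero.\<close>

lemma dvr_uniformiserI:
  fixes \<pi> :: "'a::idom"
  assumes dvr: "discrete_valuation_ring (ring_of_type_algebra :: 'a ring)"
    and unif: "uniformiser (ring_of_type_algebra :: 'a ring) \<pi>"
  shows "dvr_uniformiser \<pi>"
proof -
  define R where "R = (ring_of_type_algebra :: 'a ring)"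
  interpret discrete_valuation_ring R using dvr by (simp add: R_def)
  have R_sel [simp]: "carrier R = UNIV" "\<zero>\<^bsub>R\<^esub> = 0" "\<one>\<^bsub>R\<^esub> = 1"
      "\<And>x y. x \<otimes>\<^bsub>R\<^esub> y = x * y" "\<And>x y. x \<oplus>\<^bsub>R\<^esub> y = x + y"
    by (simp_all add: R_def ring_of_type_algebra_def)
  have PIdl: "PIdl\<^bsub>R\<^esub> p = {x. p dvd x}" for p
    unfolding R_def by (rule PIdl_ring_of_type_algebra)
  have Units: "Units R = {x. x dvd 1}"
    unfolding R_def by (rule Units_ring_of_type_algebra)
  have max: "maximalideal {x. \<pi> dvd x} R"
    using unif unfolding uniformiser_def R_def[symmetric] PIdl by simp
  show ?thesis
  proof
    show nz: "\<pi> \<noteq> 0"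
    proof
      assume "\<pi> = 0"
      then have "{x. \<pi> dvd x} = {\<zero>\<^bsub>R\<^esub>}" by auto
      then show False using max zeromaximalideal_eq_field not_field by simp
    qed
    show nu: "\<not> \<pi> dvd 1"
    proof
      assume "\<pi> dvd 1"
      then have "{x. \<pi> dvd x} = carrier R" by (auto intro: dvd_trans)
      then show False using maximalideal.I_notcarr[OF max] by simp
    qed
    have nonunit: "\<pi> dvd x" if "\<not> x dvd 1" for x
    proof (cases "x = 0")
      case False
      then have "x \<in> carrier R - {\<zero>\<^bsub>R\<^esub>}" "x \<notin> Units R"
        using \<open>\<not> x dvd 1\<close> by (simp_all add: Units)
      then obtain b where b: "ring_irreducible\<^bsub>R\<^esub> b" "b divides\<^bsub>R\<^esub> x"
        by (rule exists_irreducible_divisor)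
      have "maximalideal {x. b dvd x} R"
        using irreducible_imp_maximalideal[of b] b(1) by (simp add: PIdl)
      with max unique_maximalideal have "{x. b dvd x} = {x. \<pi> dvd x}" by blast
      moreover have "b dvd x" using b(2) by (auto simp: factor_def)
      ultimately show ?thesis by blast
    qed simp
    then show "\<not> x dvd 1 \<Longrightarrow> \<pi> dvd x" for x .
    \<comment> \<open>The intersection of the powers of the maximal ideal is principal and stable under
      division by \<open>\<pi>\<close>.\<close>
    have not_all_powers: "\<exists>k. \<not> \<pi> ^ k dvd x" if "x \<noteq> 0" for x
    proof (rule ccontr)
      define I where "I = {x. \<forall>k. \<pi> ^ k dvd x}"
      assume "\<nexists>k. \<not> \<pi> ^ k dvd x"
      then have "x \<in> I" by (simp add: I_def)
      have "ideal I R"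
      proof (rule idealI)
        show "subgroup I (add_monoid R)"
        proof
          show "inv\<^bsub>add_monoid R\<^esub> y \<in> I" if "y \<in> I" for y
          proof -
            have "inv\<^bsub>add_monoid R\<^esub> y = - y"
              using minus_equality[of "- y" y] by (simp add: a_inv_def)
            then show ?thesis using that by (simp add: I_def)
          qed
        qed (auto simp: I_def)
      qed (auto simp: I_def ring_axioms)
      then obtain a where a: "I = {x. a dvd x}" using exists_gen PIdl by auto
      then have "a \<in> I" by simp
      then have "\<pi> ^ 1 dvd a" unfolding I_def by blast
      then obtain b where b: "a = \<pi> * b" by auto
      have "b \<in> I" unfolding I_def
      proof safe
        fix k
        have "\<pi> ^ Suc k dvd \<pi> * b" using \<open>a \<in> I\<close> unfolding I_def b by blast
        then show "\<pi> ^ k dvd b" using nz by simp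
      qed
      \<comment> \<open>Since \<open>I\<close> is generated by \<open>a\<close>, which is
        \<open>\<pi> * b\<close>, membership of \<open>b\<close> makes \<open>b\<close> a multiple
        of \<open>\<pi> * b\<close>; cancelling \<open>b\<close> would turn \<pi> into a
        unit.\<close>
      then have "\<pi> * b dvd b" unfolding a b by simp
      then obtain c where "b = \<pi> * b * c" by (rule dvdE)
      then have "b * (\<pi> * c) = b * 1" by (simp add: algebra_simps)
      moreover have "b \<noteq> 0" using \<open>x \<in> I\<close> that unfolding a b by auto
      ultimately have "\<pi> * c = 1" by (simp only: mult_cancel_left) simp
      then show False using nu by (metis dvd_triv_left)
    qed
    show "\<exists>u k. u dvd 1 \<and> x = u * \<pi> ^ k" if "x \<noteq> 0" for x
    proof -
      \<comment> \<open>\<open>m\<close> is positive because \<open>\<pi> ^ 0\<close> divides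
        everything; its predecessor \<open>k\<close> is the valuation of \<open>x\<close>.\<close>
      define m where "m = (LEAST k. \<not> \<pi> ^ k dvd x)"
      have m: "\<not> \<pi> ^ m dvd x"
        unfolding m_def using not_all_powers[OF \<open>x \<noteq> 0\<close>] by (rule LeastI_ex)
      then obtain k where k: "m = Suc k" by (cases m) auto
      then have "\<pi> ^ k dvd x" using not_less_Least[of k "\<lambda>k. \<not> \<pi> ^ k dvd x"] by (auto simp: m_def[symmetric])
      then obtain u where u: "x = \<pi> ^ k * u" by blast
      then have "\<not> \<pi> dvd u" using m k by (auto simp: mult.commute)
      then have "u dvd 1" using nonunit by blast
      then show ?thesis using u by (auto simp: mult.commute)
    qed
  qed
qed

lemma smult_mat_left_cancel:
  fixes c :: "'a::idom"
  assumes "c \<noteq> 0" and eq: "c \<cdot>\<^sub>m A = c \<cdot>\<^sub>m B"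
  shows "A = B"
proof (rule eq_matI)
  show dims: "dim_row A = dim_row B" "dim_col A = dim_col B"
    using arg_cong[OF eq, of dim_row] arg_cong[OF eq, of dim_col] by simp_all
  show "A $$ (i, j) = B $$ (i, j)" if "i < dim_row B" "j < dim_col B" for i j
    using arg_cong[OF eq, of "\<lambda>M. M $$ (i, j)"] that dims \<open>c \<noteq> 0\<close> by simp
qed

interpretation to_fract_hom: inj_comm_ring_hom to_fract
  by unfold_locales simp_all

section \<open>General linear groups\<close>

lemma GL_carrier: "A \<in> GL n \<Longrightarrow> A \<in> carrier_mat n n"
  by (simp add: GL_def)

text \<open>\<open>invertible_mat\<close> does not fix the shape of the inverse; comparing
  dimensions in the two products forces it to be square of size \<open>n\<close>.\<close>

lemma GL_iff_inverse:
  "A \<in> GL n \<longleftrightarrow> A \<in> carrier_mat n n \<and> (\<exists>B \<in> carrier_mat n n. A * B = 1\<^sub>m n \<and> B * A = 1\<^sub>m n)"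
proof
  assume "A \<in> GL n"
  then obtain B where A: "A \<in> carrier_mat n n"
    and B: "A * B = 1\<^sub>m n" "B * A = 1\<^sub>m (dim_row B)"
    unfolding GL_def invertible_mat_def inverts_mat_def by auto
  have "B \<in> carrier_mat n n"
    using A B by (metis carrier_matD carrier_matI index_mult_mat(2,3) index_one_mat(2,3))
  then show "A \<in> carrier_mat n n \<and> (\<exists>B \<in> carrier_mat n n. A * B = 1\<^sub>m n \<and> B * A = 1\<^sub>m n)"
    using A B by auto
next
  assume "A \<in> carrier_mat n n \<and> (\<exists>B \<in> carrier_mat n n. A * B = 1\<^sub>m n \<and> B * A = 1\<^sub>m n)"
  then show "A \<in> GL n"
    unfolding GL_def invertible_mat_def inverts_mat_def by auto
qed

text \<open>The adjugate scaled by the inverse of the determinant is the inverse matrix; the other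
  direction is multiplicativity of the determinant.\<close>

lemma GL_iff_det:
  fixes A :: "'a::comm_ring_1 mat"
  shows "A \<in> GL n \<longleftrightarrow> A \<in> carrier_mat n n \<and> det A dvd 1"
proof (cases "A \<in> carrier_mat n n")
  case A: True
  show ?thesis
  proof
    assume "A \<in> GL n"
    then obtain B where "B \<in> carrier_mat n n" "A * B = 1\<^sub>m n" by (auto simp: GL_iff_inverse)
    then have "det A * det B = 1" using det_mult[OF A] by (metis det_one)
    then show "A \<in> carrier_mat n n \<and> det A dvd 1" using A by (metis dvd_triv_left)
  next
    assume "A \<in> carrier_mat n n \<and> det A dvd 1"
    then obtain v where v: "det A * v = 1" by (metis dvdE)
    let ?B = "v \<cdot>\<^sub>m adj_mat A"
    note adj = adj_mat[OF A]
    have "A * ?B = 1\<^sub>m n" "?B * A = 1\<^sub>m n"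
      using A adj v by (auto simp: mult_smult_distrib[of _ n n _ n] mult_smult_assoc_mat[of _ n n _ n]
          smult_smult_assoc mult.commute)
    then show "A \<in> GL n" using A adj(1) by (auto simp: GL_iff_inverse intro!: bexI[of _ ?B])
  qed
qed (simp add: GL_def)

lemma GL_one: "1\<^sub>m n \<in> GL n"
  by (simp add: GL_iff_det)

lemma GL_mult:
  assumes "A \<in> GL n" "B \<in> GL n"
  shows "A * B \<in> GL n"
  using assms mult_dvd_mono[of "det A" 1 "det B" 1] by (auto simp: GL_iff_det det_mult)

lemma GL_inverse:
  assumes "A \<in> GL n"
  obtains B where "B \<in> GL n" "A * B = 1\<^sub>m n" "B * A = 1\<^sub>m n"
  using assms unfolding GL_iff_inverse by blast

text \<open>Serves to extend the transformations of the upper left block to the whole matrix in the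
  induction for the Smith normal form.\<close>

lemma GL_block_diag:
  fixes A :: "'a::idom mat"
  assumes "A \<in> GL n" "B \<in> GL m"
  shows "four_block_mat A (0\<^sub>m n m) (0\<^sub>m m n) B \<in> GL (n + m)"
  using assms mult_dvd_mono[of "det A" 1 "det B" 1]
  by (auto simp: GL_iff_det det_four_block_mat_lower_left_zero[of A n _ m])

lemma swaprows_mat_GL: "k < n \<Longrightarrow> l < n \<Longrightarrow> swaprows_mat n k l \<in> GL n"
  by (auto simp: GL_iff_inverse intro!: bexI[of _ "swaprows_mat n k l"] swaprows_mat_inv)

lemma mult_mat_regroup:
  fixes A B C D E :: "'a::semiring_0 mat"
  assumes "A \<in> carrier_mat n n" "B \<in> carrier_mat n n" "C \<in> carrier_mat n n"
    "D \<in> carrier_mat n n" "E \<in> carrier_mat n n"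
  shows "A * (B * C * D) * E = (A * B) * C * (D * E)"
proof -
  note [simp] = assoc_mult_mat[of _ n n _ n _ n] mult_carrier_mat[of _ n n _ n]
  show ?thesis using assms by simp
qed

section \<open>Smith normal form\<close>

text \<open>Block elimination with the unit corner entry as pivot; the remaining block
  \<open>B\<close> is the Schur complement of that entry.\<close>

lemma clear_row_and_column:
  fixes A :: "'a::idom mat"
  assumes A: "A \<in> carrier_mat (n + 1) (n + 1)" and unit: "A $$ (n, n) dvd 1"
  obtains P Q B where "P \<in> GL (n + 1)" "Q \<in> GL (n + 1)" "B \<in> carrier_mat n n"
    "P * A * Q = four_block_mat B (0\<^sub>m n 1) (0\<^sub>m 1 n) (1\<^sub>m 1)"
proof -
  obtain A1 b c d where split: "split_block A n n = (A1, b, c, d)" by (metis prod_cases4)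
  note s = split_block[OF split, of 1 1]
  have dims: "A1 \<in> carrier_mat n n" "b \<in> carrier_mat n 1" "c \<in> carrier_mat 1 n"
    "d \<in> carrier_mat 1 1" and A_eq: "A = four_block_mat A1 b c d"
    using s A by auto
  obtain v where v: "A $$ (n, n) * v = 1" using unit by (metis dvdE)
  have "A $$ (n, n) = d $$ (0, 0)" using carrier_matD[OF dims(1)] dims(4) unfolding A_eq by auto
  then have d: "v \<cdot>\<^sub>m d = 1\<^sub>m 1" using v dims(4)
    by (intro eq_matI) (auto simp: mult.commute)
  \<comment> \<open>\<open>L\<close> clears the column above the pivot and rescales the last row to
    make the pivot 1; \<open>U\<close> then clears the row to its left.\<close>
  define L where "L = four_block_mat (1\<^sub>m n) (- v \<cdot>\<^sub>m b) (0\<^sub>m 1 n) (v \<cdot>\<^sub>m 1\<^sub>m 1)"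
  define U where "U = four_block_mat (1\<^sub>m n) (0\<^sub>m n 1) (- v \<cdot>\<^sub>m c) (1\<^sub>m 1)"
  define B where "B = A1 + - v \<cdot>\<^sub>m b * c"
  have bd: "- v \<cdot>\<^sub>m b * d = - b"
  proof -
    have "- v \<cdot>\<^sub>m b * d = - (b * (v \<cdot>\<^sub>m d))"
      using dims
      by (intro eq_matI)
        (simp_all add: mult_smult_distrib[of _ n 1 _ 1] mult_smult_assoc_mat[of _ n 1 _ 1])
    then show ?thesis using d dims by simp
  qed
  have LA: "L * A = four_block_mat B (0\<^sub>m n 1) (v \<cdot>\<^sub>m c) (1\<^sub>m 1)"
    unfolding L_def A_eq
    apply (subst mult_four_block_mat[of _ n n _ 1 _ 1 _ _ n _ 1])
    using dims d bd by (auto simp: B_def mult_smult_assoc_mat[of _ 1 1 _ n] mult_smult_assoc_mat[of _ 1 1 _ 1])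
  have "L * A * U = four_block_mat B (0\<^sub>m n 1) (0\<^sub>m 1 n) (1\<^sub>m 1)"
    unfolding LA U_def
    apply (subst mult_four_block_mat[of _ n n _ 1 _ 1 _ _ n _ 1])
    using dims by (auto simp: B_def)
  moreover have "L \<in> GL (n + 1)"
    using dims v
    by (auto simp: L_def GL_iff_det det_four_block_mat_lower_left_zero[of _ n _ 1] dvd_def mult.commute)
  moreover have "U \<in> GL (n + 1)"
    using dims by (auto simp: U_def GL_iff_det det_four_block_mat_upper_right_zero[of _ n _ 1])
  ultimately show ?thesis using that[of L U B] dims mult_carrier_mat[of "- v \<cdot>\<^sub>m b" n 1 c n] by (simp add: B_def)
qed


text \<open>Swapping row \<open>r\<close> and column \<open>c\<close> with the last ones brings the
  unit to the corner, where elimination applies.\<close>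

lemma split_off_unit_entry:
  fixes A :: "'a::idom mat"
  assumes A: "A \<in> carrier_mat (n + 1) (n + 1)"
    and rc: "r < n + 1" "c < n + 1" and unit: "A $$ (r, c) dvd 1"
  obtains P Q B where "P \<in> GL (n + 1)" "Q \<in> GL (n + 1)" "B \<in> carrier_mat n n"
    "P * A * Q = four_block_mat B (0\<^sub>m n 1) (0\<^sub>m 1 n) (1\<^sub>m 1)"
proof -
  let ?S = "swaprows_mat (n + 1) r n" and ?T = "swaprows_mat (n + 1) c n"
  have SAT: "?S * A * ?T = swapcols c n (swaprows r n A)"
    using A rc swapcols_mat[of "swaprows r n A" "Suc n" "Suc n" c n]
    by (simp add: swaprows_mat[of _ _ "Suc n", symmetric])
  have "(?S * A * ?T) $$ (n, n) dvd 1"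
    unfolding SAT using A rc unit by auto
  moreover have "?S * A * ?T \<in> carrier_mat (n + 1) (n + 1)" using A by auto
  ultimately obtain P Q B where *: "P \<in> GL (n + 1)" "Q \<in> GL (n + 1)" "B \<in> carrier_mat n n"
    "P * (?S * A * ?T) * Q = four_block_mat B (0\<^sub>m n 1) (0\<^sub>m 1 n) (1\<^sub>m 1)"
    using clear_row_and_column by blast
  have "P * ?S * A * (?T * Q) = P * (?S * A * ?T) * Q"
    using A GL_carrier[OF *(1)] GL_carrier[OF *(2)]
    by (intro mult_mat_regroup[symmetric]) auto
  then show ?thesis
    using that[of "P * ?S" "?T * Q" B] * rc by (auto intro!: GL_mult swaprows_mat_GL)
qed

context dvr_uniformiser
begin

lemma power_dvd_unit_times_power:
  assumes "u dvd 1" "\<pi> ^ k dvd u * \<pi> ^ m"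
  shows "k \<le> m"
proof (rule ccontr)
  assume "\<not> k \<le> m"
  then have "\<pi> ^ m * \<pi> dvd \<pi> ^ k" using le_imp_power_dvd[of "Suc m" k \<pi>] by (simp add: mult.commute)
  then have "\<pi> ^ m * \<pi> dvd \<pi> ^ m * u" using assms(2) by (metis dvd_trans mult.commute)
  then have "\<pi> dvd u" using uniformiser_nonzero by simp
  then show False using assms(1) uniformiser_nonunit dvd_trans by blast
qed

text \<open>Take the largest \<open>k\<close> for which \<open>\<pi> ^ k\<close> divides all
  entries. The nonzero entry bounds \<open>k\<close>, and by maximality some quotient is not
  divisible by \<pi>, hence is a unit.\<close>

lemma extract_power:
  assumes A: "A \<in> carrier_mat m n" and nz: "i < m" "j < n" "A $$ (i, j) \<noteq> 0"
  obtains k B r c where "A = \<pi> ^ k \<cdot>\<^sub>m B" "B \<in> carrier_mat m n"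
    "r < m" "c < n" "B $$ (r, c) dvd 1"
proof -
  define D where "D k \<longleftrightarrow> (\<forall>i<m. \<forall>j<n. \<pi> ^ k dvd A $$ (i, j))" for k
  obtain u l where ul: "u dvd 1" "A $$ (i, j) = u * \<pi> ^ l" using unit_times_power[OF nz(3)] by blast
  have bound: "k \<le> l" if "D k" for k
    using that nz power_dvd_unit_times_power[OF ul(1)] by (auto simp: D_def ul(2)[symmetric])
  have "D 0" by (simp add: D_def)
  then obtain k where k: "D k" "\<And>k'. D k' \<Longrightarrow> k' \<le> k"
    using bound by (metis GreatestI_nat Greatest_le_nat)
  then obtain b where b: "\<And>i j. i < m \<Longrightarrow> j < n \<Longrightarrow> A $$ (i, j) = \<pi> ^ k * b i j"
    unfolding D_def dvd_def by metis
  have "\<exists>r<m. \<exists>c<n. b r c dvd 1"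
  proof (rule ccontr)
    assume "\<not> ?thesis"
    then have "\<pi> dvd b r c" if "r < m" "c < n" for r c
      using that uniformiser_dvd_nonunit by blast
    then have "D (Suc k)" unfolding D_def using b by (auto simp: mult.commute intro: mult_dvd_mono)
    then show False using k(2) by fastforce
  qed
  then obtain r c where "r < m" "c < n" "b r c dvd 1" by blast
  then show ?thesis
    using A b by (intro that[of k "mat m n (\<lambda>(i, j). b i j)" r c]) auto
qed

text \<open>Induction on \<open>n\<close>. The common power \<open>\<pi> ^ k\<close> is extracted
  before a unit is split off, so the exponents from the remaining block all become at least
  \<open>k\<close>, the exponent in the last place.\<close>

lemma smith_normal_form:
  assumes "A \<in> carrier_mat n n" "det A \<noteq> 0"
  shows "\<exists>P \<in> GL n. \<exists>Q \<in> GL n. \<exists>f :: nat \<Rightarrow> nat.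
    (\<forall>i j. i \<le> j \<and> j < n \<longrightarrow> f j \<le> f i) \<and> P * A * Q = mat_diag n (\<lambda>i. \<pi> ^ f i)"
  using assms
proof (induction n arbitrary: A)
  case 0
  then show ?case
    by (intro bexI[of _ "1\<^sub>m 0"] exI[of _ id]) (auto simp: GL_one mat_diag_def intro!: eq_matI)
next
  case (Suc n)
  note A = Suc.prems(1)
  have "\<exists>i<Suc n. \<exists>j<Suc n. A $$ (i, j) \<noteq> 0"
  proof (rule ccontr)
    assume "\<not> ?thesis"
    then have "A = 0 \<cdot>\<^sub>m A" using A by (intro eq_matI) auto
    then have "det A = 0" using A det_smult[of 0 A] by simp
    then show False using Suc.prems by simp
  qed
  then obtain k A0 r c where A0: "A = \<pi> ^ k \<cdot>\<^sub>m A0" "A0 \<in> carrier_mat (n + 1) (n + 1)"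
    "r < n + 1" "c < n + 1" "A0 $$ (r, c) dvd 1"
    using extract_power[OF A] by (metis Suc_eq_plus1)
  obtain P Q B where PQ: "P \<in> GL (n + 1)" "Q \<in> GL (n + 1)" and B: "B \<in> carrier_mat n n"
    and PAQ: "P * A0 * Q = four_block_mat B (0\<^sub>m n 1) (0\<^sub>m 1 n) (1\<^sub>m 1)"
    using split_off_unit_entry[OF A0(2-5)] .
  note PQ_carrier = PQ[THEN GL_carrier]
  \<comment> \<open>The induction hypothesis asks for a block with nonzero determinant;
    \<open>det B\<close> equals the determinant of \<open>P * A0 * Q\<close>.\<close>
  have "det P \<noteq> 0" "det Q \<noteq> 0" using PQ by (auto simp: GL_iff_det)
  moreover have "det A0 \<noteq> 0" using Suc.prems(2) A0(1) by auto
  ultimately have "det (P * A0 * Q) \<noteq> 0"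
    using PQ_carrier A0(2) by (simp add: det_mult[of _ "Suc n"])
  then have "det B \<noteq> 0"
    unfolding PAQ using B by (simp add: det_four_block_mat_lower_left_zero[of _ n _ 1])
  from Suc.IH[OF B this] obtain P' Q' f where P'Q': "P' \<in> GL n" "Q' \<in> GL n"
    and f: "\<And>i j. i \<le> j \<Longrightarrow> j < n \<Longrightarrow> f j \<le> f i"
    and P'BQ': "P' * B * Q' = mat_diag n (\<lambda>i. \<pi> ^ f i)" by blast
  note P'Q'_carrier = P'Q'[THEN GL_carrier]
  let ?bd = "\<lambda>Y. four_block_mat Y (0\<^sub>m n 1) (0\<^sub>m 1 n) (1\<^sub>m 1)"
  \<comment> \<open>Restoring \<open>\<pi> ^ k\<close> adds \<open>k\<close> to the exponents of the
    block and replaces the split-off 1 at index \<open>n\<close> by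
    \<open>\<pi> ^ k\<close>.\<close>
  let ?f = "\<lambda>i. if i < n then k + f i else k"
  have bd_GL: "?bd P' \<in> GL (n + 1)" "?bd Q' \<in> GL (n + 1)"
    using P'Q' by (auto intro!: GL_block_diag GL_one simp del: One_nat_def)
  note bd_carrier = bd_GL[THEN GL_carrier]
  have "(?bd P' * P) * A * (Q * ?bd Q') = \<pi> ^ k \<cdot>\<^sub>m ((?bd P' * P) * A0 * (Q * ?bd Q'))"
    using A0 PQ_carrier bd_carrier
    by (simp add: mult_smult_distrib[of _ "Suc n" "Suc n" _ "Suc n"] mult_smult_assoc_mat[of _ "Suc n" "Suc n" _ "Suc n"])
  also have "(?bd P' * P) * A0 * (Q * ?bd Q') = ?bd P' * (P * A0 * Q) * ?bd Q'"
    using A0 PQ_carrier bd_carrier by (intro mult_mat_regroup[symmetric]) auto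
  also have "?bd P' * (P * A0 * Q) * ?bd Q' = ?bd (P' * B * Q')"
    unfolding PAQ using P'Q'_carrier B
    by (simp add: mult_four_block_mat[of _ n n _ 1 _ 1 _ _ n _ 1])
  also have "\<pi> ^ k \<cdot>\<^sub>m ?bd (P' * B * Q') = mat_diag (Suc n) (\<lambda>i. \<pi> ^ ?f i)"
    unfolding P'BQ' by (intro eq_matI) (auto simp: mat_diag_def power_add)
  finally have "(?bd P' * P) * A * (Q * ?bd Q') = mat_diag (Suc n) (\<lambda>i. \<pi> ^ ?f i)" .
  moreover have "?bd P' * P \<in> GL (Suc n)" "Q * ?bd Q' \<in> GL (Suc n)"
    using GL_mult[OF bd_GL(1) PQ(1)] GL_mult[OF PQ(2) bd_GL(2)] by simp_all
  moreover have "\<forall>i j. i \<le> j \<and> j < Suc n \<longrightarrow> ?f j \<le> ?f i" using f by auto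
  ultimately show ?case by (intro bexI exI conjI)
qed

section \<open>From the ring to its fraction field\<close>

text \<open>Up to a unit a denominator is a power of \<pi>, so multiplying by that power
  suffices.\<close>

lemma clear_denominator: "\<exists>k. x * to_fract \<pi> ^ k \<in> range to_fract"
proof (cases x)
  case (Fract a b)
  from unit_times_power[OF \<open>b \<noteq> 0\<close>] obtain u k where "u dvd 1" and b: "b = u * \<pi> ^ k" by blast
  then obtain v where v: "u * v = 1" by (metis dvdE)
  have "x * to_fract b = to_fract a"
    using Fract \<open>b \<noteq> 0\<close> by (simp add: Fract_conv_to_fract)
  moreover have "b * v = \<pi> ^ k * (u * v)" by (simp add: b)
  ultimately have "x * to_fract (\<pi> ^ k) = to_fract (a * v)"
    unfolding v by (metis mult.assoc mult.right_neutral to_fract_mult)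
  then have "x * to_fract \<pi> ^ k = to_fract (a * v)" by (simp add: to_fract_hom.hom_power)
  then show ?thesis by blast
qed

lemma clear_denominators:
  assumes "finite S"
  shows "\<exists>k. \<forall>x\<in>S. x * to_fract \<pi> ^ k \<in> range to_fract"
  using assms
proof (induction S)
  case (insert x S)
  then obtain k where k: "\<And>y. y \<in> S \<Longrightarrow> y * to_fract \<pi> ^ k \<in> range to_fract" by blast
  obtain l where l: "x * to_fract \<pi> ^ l \<in> range to_fract" using clear_denominator by blast
  \<comment> \<open>A larger exponent works as well, so a single exponent, the sum, serves old and
    new elements alike.\<close>
  have *: "y * to_fract \<pi> ^ (i + j) \<in> range to_fract" if y: "y * to_fract \<pi> ^ i \<in> range to_fract" for y i j
  proof -
    obtain a where "y * to_fract \<pi> ^ i = to_fract a" using y by blast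
    then have "y * to_fract \<pi> ^ (i + j) = to_fract (a * \<pi> ^ j)"
      by (simp add: power_add to_fract_hom.hom_power flip: mult.assoc)
    then show ?thesis by blast
  qed
  then show ?case using k *[OF l, of k] *[OF k, of _ l] by (intro exI[of _ "l + k"]) (auto simp: add.commute)
qed simp

text \<open>Scale by a power of \<pi> to get entries in the ring, apply the Smith normal form there,
  then undo the scaling in the exponents.\<close>

lemma GL_fract_decomposition:
  fixes A :: "'a fract mat"
  assumes "A \<in> GL n"
  shows "\<exists>g \<in> GL_integral n. \<exists>t \<in> T_minus n \<pi>. \<exists>h \<in> GL_integral n. A = g * t * h"
proof -
  let ?p = "to_fract \<pi>" and ?F = "map_mat to_fract :: 'a mat \<Rightarrow> 'a fract mat"
  have p: "?p \<noteq> 0" using uniformiser_nonzero by simp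
  have A: "A \<in> carrier_mat n n" by (rule GL_carrier[OF assms])
  have "finite (($$) A ` ({..<n} \<times> {..<n}))" by simp
  from clear_denominators[OF this] obtain k
    where k: "\<forall>x \<in> ($$) A ` ({..<n} \<times> {..<n}). x * ?p ^ k \<in> range to_fract" ..
  \<comment> \<open>The guards stand under the existential so that the choice function
    \<open>b\<close> is total in the indices.\<close>
  have "\<exists>b. i < n \<longrightarrow> j < n \<longrightarrow> A $$ (i, j) * ?p ^ k = to_fract b" for i j
    using k by (cases "i < n \<and> j < n") auto
  then obtain b where b: "\<And>i j. i < n \<Longrightarrow> j < n \<Longrightarrow> A $$ (i, j) * ?p ^ k = to_fract (b i j)"
    by metis
  define B where "B = mat n n (\<lambda>(i, j). b i j)"
  have B: "B \<in> carrier_mat n n" by (simp add: B_def)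
  have FB: "?F B = ?p ^ k \<cdot>\<^sub>m A"
    using A b by (intro eq_matI) (auto simp: B_def mult.commute)
  have "det A \<noteq> 0" using assms by (auto simp: GL_iff_det)
  then have "det (?F B) \<noteq> 0" unfolding FB using p by simp
  then have "det B \<noteq> 0" by (auto simp: to_fract_hom.hom_det)
  from smith_normal_form[OF B this] obtain P Q f where PQ: "P \<in> GL n" "Q \<in> GL n"
    and f: "\<And>i j. i \<le> j \<Longrightarrow> j < n \<Longrightarrow> f j \<le> f i"
    and PBQ: "P * B * Q = mat_diag n (\<lambda>i. \<pi> ^ f i)" by blast
  note PQ_carrier = PQ[THEN GL_carrier]
  obtain P' Q' where P': "P' \<in> GL n" "P' * P = 1\<^sub>m n" and Q': "Q' \<in> GL n" "Q * Q' = 1\<^sub>m n"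
    using PQ by (metis GL_inverse)
  \<comment> \<open>Subtracting \<open>k\<close> undoes the scaling; a constant shift preserves the
    order of the exponents but may make them negative.\<close>
  let ?t = "mat_diag n (\<lambda>i. ?p powi (int (f i) - int k))"
  have "?p ^ k \<cdot>\<^sub>m (?F P * A * ?F Q) = ?F P * ?F B * ?F Q"
    unfolding FB using PQ_carrier A
    by (simp add: mult_smult_distrib[of _ n n _ n] mult_smult_assoc_mat[of _ n n _ n])
  also have "\<dots> = ?F (P * B * Q)"
    using PQ_carrier B by (simp add: to_fract_hom.mat_hom_mult[of _ n n _ n])
  also have "\<dots> = ?p ^ k \<cdot>\<^sub>m ?t"
    unfolding PBQ using p
    by (intro eq_matI) (auto simp: mat_diag_def power_int_diff to_fract_hom.hom_power)
  finally have *: "?p ^ k \<cdot>\<^sub>m (?F P * A * ?F Q) = ?p ^ k \<cdot>\<^sub>m ?t" .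
  have t: "?F P * A * ?F Q = ?t"
    using p by (intro smult_mat_left_cancel[OF _ *]) simp
  have "?F P' * ?F P = 1\<^sub>m n" "?F Q * ?F Q' = 1\<^sub>m n"
    using P' Q' PQ_carrier GL_carrier[OF P'(1)] GL_carrier[OF Q'(1)]
    by (simp_all add: to_fract_hom.mat_hom_one flip: to_fract_hom.mat_hom_mult[of _ n n _ n])
  moreover have "?F P' * ?t * ?F Q' = (?F P' * ?F P) * A * (?F Q * ?F Q')"
    unfolding t[symmetric] using PQ_carrier A P'(1)[THEN GL_carrier] Q'(1)[THEN GL_carrier]
    by (intro mult_mat_regroup) auto
  ultimately have "A = ?F P' * ?t * ?F Q'" using A by simp
  moreover have "?t \<in> T_minus n \<pi>"
    using f by (auto simp: T_minus_def intro!: exI[of _ "\<lambda>i. int (f i) - int k"])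
  ultimately show ?thesis using P' Q' unfolding GL_integral_def by blast
qed

end

section \<open>Uniqueness of the diagonal part\<close>

text \<open>Pigeonhole: an injection cannot send the \<open>k + 1\<close> indices up to
  \<open>k\<close> into the \<open>k\<close> indices below \<open>k\<close>.\<close>

lemma permutes_meets_block:
  fixes n k :: nat
  assumes "p permutes {0..<n}" "k < n"
  shows "\<exists>i\<le>k. k \<le> p i \<and> p i < n"
proof (rule ccontr)
  assume "\<not> ?thesis"
  moreover have "p i < n" if "i \<le> k" for i
    using that \<open>k < n\<close> permutes_in_image[OF assms(1), of i] by simp
  ultimately have "p ` {0..k} \<subseteq> {0..<k}" by fastforce
  then have "card (p ` {0..k}) \<le> k"
    using card_mono[of "{0..<k}"] by fastforce
  moreover have "card (p ` {0..k}) = k + 1"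
    using permutes_inj_on[OF assms(1)] by (subst card_image) auto
  ultimately show False by simp
qed

text \<open>In the Leibniz expansion each permutation picks an entry from the block, so every
  summand is divisible by \<open>d\<close>.\<close>

lemma dvd_det_if_dvd_block:
  fixes A :: "'a::comm_ring_1 mat"
  assumes A: "A \<in> carrier_mat n n" and "k < n"
    and block: "\<And>i j. i \<le> k \<Longrightarrow> k \<le> j \<Longrightarrow> j < n \<Longrightarrow> d dvd A $$ (i, j)"
  shows "d dvd det A"
  unfolding det_def'[OF A]
proof (rule dvd_sum, safe)
  fix p assume "p permutes {0..<n}"
  with \<open>k < n\<close> obtain i where "i \<le> k" "k \<le> p i" "p i < n" by (metis permutes_meets_block)
  then have "d dvd A $$ (i, p i)" "i \<in> {0..<n}" using block \<open>k < n\<close> by auto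
  then have "d dvd (\<Prod>i = 0..<n. A $$ (i, p i))" by (meson dvd_prodI dvd_trans finite_atLeastLessThan)
  then show "d dvd signof p * (\<Prod>i = 0..<n. A $$ (i, p i))" by simp
qed

context dvr_uniformiser
begin

text \<open>Comparing entries shows that \<open>g $$ (i, j)\<close> is \<open>h $$ (i, j)\<close>
  times \<pi> to the power \<open>f' i - f j\<close>. If the claim fails, this exponent is positive
  throughout the block \<open>i \<le> k \<le> j\<close>, so \<pi> divides the unit
  \<open>det g\<close>.\<close>

lemma exponents_le:
  fixes f f' :: "nat \<Rightarrow> int"
  assumes g: "g \<in> GL n" and h: "h \<in> GL n"
    and f: "\<And>i j. i \<le> j \<Longrightarrow> j < n \<Longrightarrow> f i \<ge> f j"
    and f': "\<And>i j. i \<le> j \<Longrightarrow> j < n \<Longrightarrow> f' i \<ge> f' j"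
    and eq: "map_mat to_fract g * mat_diag n (\<lambda>i. to_fract \<pi> powi f i) =
      mat_diag n (\<lambda>i. to_fract \<pi> powi f' i) * map_mat to_fract h"
    and "k < n"
  shows "f' k \<le> f k"
proof (rule ccontr)
  let ?p = "to_fract \<pi>"
  have p: "?p \<noteq> 0" using uniformiser_nonzero by simp
  assume less: "\<not> f' k \<le> f k"
  note carrier = g[THEN GL_carrier] h[THEN GL_carrier]
  have "\<pi> dvd g $$ (i, j)" if ij: "i \<le> k" "k \<le> j" "j < n" for i j
  proof -
    \<comment> \<open>Monotonicity of both sequences gives the chain
      \<open>f' i \<ge> f' k > f k \<ge> f j\<close>.\<close>
    have gt: "f' i > f j" using less f'[OF ij(1) \<open>k < n\<close>] f[OF ij(2,3)] by simp
    have "(map_mat to_fract g * mat_diag n (\<lambda>i. ?p powi f i)) $$ (i, j) =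
        to_fract (g $$ (i, j)) * ?p powi f j"
      using carrier ij \<open>k < n\<close> by (subst mat_diag_mult_right[of _ n n]) auto
    moreover have "(mat_diag n (\<lambda>i. ?p powi f' i) * map_mat to_fract h) $$ (i, j) =
        ?p powi f' i * to_fract (h $$ (i, j))"
      using carrier ij \<open>k < n\<close> by (subst mat_diag_mult_left[of _ n n]) auto
    ultimately have "to_fract (g $$ (i, j)) * ?p powi f j = ?p powi f' i * to_fract (h $$ (i, j))"
      using eq by simp
    moreover have "?p powi f' i = ?p ^ nat (f' i - f j) * ?p powi f j"
      using p gt by (simp flip: power_int_add power_int_of_nat)
    ultimately have "to_fract (g $$ (i, j)) = to_fract (\<pi> ^ nat (f' i - f j) * h $$ (i, j))"
      using p by (simp add: to_fract_hom.hom_power)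
    then have "g $$ (i, j) = \<pi> ^ nat (f' i - f j) * h $$ (i, j)" by (simp only: to_fract_eq_iff)
    moreover have "\<pi> dvd \<pi> ^ nat (f' i - f j)" using gt by (intro dvd_power) auto
    ultimately show ?thesis by simp
  qed
  then have "\<pi> dvd det g" using carrier \<open>k < n\<close> by (intro dvd_det_if_dvd_block) auto
  moreover have "det g dvd 1" using g by (simp add: GL_iff_det)
  ultimately show False using uniformiser_nonunit dvd_trans by blast
qed

end

section \<open>The subgroup of integral invertible matrices\<close>

lemma GL_integral_carrier: "A \<in> GL_integral n \<Longrightarrow> A \<in> carrier_mat n n"
  by (auto simp: GL_integral_def dest: GL_carrier)

lemma GL_integral_mult:
  assumes "A \<in> GL_integral n" "B \<in> GL_integral n"
  shows "A * B \<in> GL_integral n"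
proof -
  obtain a b where ab: "A = map_mat to_fract a" "B = map_mat to_fract b" "a \<in> GL n" "b \<in> GL n"
    using assms by (auto simp: GL_integral_def)
  then have "A * B = map_mat to_fract (a * b)"
    by (simp add: to_fract_hom.mat_hom_mult[OF GL_carrier GL_carrier])
  then show ?thesis unfolding GL_integral_def using GL_mult ab by blast
qed

lemma GL_integral_inverse:
  assumes "A \<in> GL_integral n"
  obtains B where "B \<in> GL_integral n" "A * B = 1\<^sub>m n" "B * A = 1\<^sub>m n"
proof -
  obtain a where a: "A = map_mat to_fract a" "a \<in> GL n"
    using assms by (auto simp: GL_integral_def)
  obtain b where b: "b \<in> GL n" "a * b = 1\<^sub>m n" "b * a = 1\<^sub>m n" using GL_inverse[OF a(2)] .
  show ?thesis
  proof (rule that)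
    show "map_mat to_fract b \<in> GL_integral n" using b by (simp add: GL_integral_def)
  qed (simp_all add: a b GL_carrier to_fract_hom.mat_hom_one flip: to_fract_hom.mat_hom_mult[of _ n n _ n])
qed

lemma GL_integral_subset: "(GL_integral n :: 'a::idom fract mat set) \<subseteq> GL n"
proof
  fix A :: "'a fract mat" assume A: "A \<in> GL_integral n"
  then obtain B where "B \<in> GL_integral n" "A * B = 1\<^sub>m n" "B * A = 1\<^sub>m n"
    by (rule GL_integral_inverse)
  with A show "A \<in> GL n" unfolding GL_iff_inverse using GL_integral_carrier by blast
qed

lemma T_minus_subset_GL:
  assumes "p \<noteq> 0"
  shows "T_minus n p \<subseteq> GL n"
proof
  fix t assume "t \<in> T_minus n p"
  then obtain f :: "nat \<Rightarrow> int" where t: "t = mat_diag n (\<lambda>i. to_fract p powi f i)"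
    by (auto simp: T_minus_def)
  show "t \<in> GL n"
    unfolding GL_iff_inverse t using assms
    by (auto intro!: bexI[of _ "mat_diag n (\<lambda>i. to_fract p powi (- f i))"] simp flip: power_int_add)
qed

section \<open>Disjointness and the decomposition\<close>

text \<open>The inequality of exponents applies twice: to the given relation and to the inverted
  one, \<open>g' * t' = t * h'\<close>, in which \<open>t\<close> and \<open>t'\<close> exchange
  roles.\<close>

lemma (in dvr_uniformiser) T_minus_eqI:
  assumes t: "t \<in> T_minus n \<pi>" and t': "t' \<in> T_minus n \<pi>"
    and g: "g \<in> GL_integral n" and h: "h \<in> GL_integral n" and eq: "g * t = t' * h"
  shows "t = t'"
proof -
  let ?D = "\<lambda>f. mat_diag n (\<lambda>i. to_fract \<pi> powi f i)"
  obtain f where f: "t = ?D f" "\<And>i j. i \<le> j \<Longrightarrow> j < n \<Longrightarrow> f i \<ge> f j"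
    using t unfolding T_minus_def by blast
  obtain f' where f': "t' = ?D f'" "\<And>i j. i \<le> j \<Longrightarrow> j < n \<Longrightarrow> f' i \<ge> f' j"
    using t' unfolding T_minus_def by blast
  obtain g' where g': "g' \<in> GL_integral n" "g' * g = 1\<^sub>m n" using GL_integral_inverse[OF g] by metis
  obtain h' where h': "h' \<in> GL_integral n" "h * h' = 1\<^sub>m n" using GL_integral_inverse[OF h] by metis
  note carrier = g[THEN GL_integral_carrier] h[THEN GL_integral_carrier]
    g'(1)[THEN GL_integral_carrier] h'(1)[THEN GL_integral_carrier]
  have D: "t \<in> carrier_mat n n" "t' \<in> carrier_mat n n" by (simp_all add: f f')
  have "g' * t' = g' * (t' * (h * h'))" using D by (simp add: h')
  also have "\<dots> = g' * ((t' * h) * h')" using D carrier by (simp add: assoc_mult_mat[of _ n n _ n _ n])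
  also have "\<dots> = (g' * g) * t * h'"
    unfolding eq[symmetric] using D carrier by (simp add: assoc_mult_mat[of _ n n _ n _ n])
  also have "\<dots> = t * h'" using D by (simp add: g')
  finally have eq': "g' * t' = t * h'" .
  have "f i = f' i" if "i < n" for i
  proof (rule antisym)
    show "f' i \<le> f i"
      using g h eq f(2) f'(2) that unfolding f(1) f'(1) GL_integral_def
      by (auto intro: exponents_le)
    show "f i \<le> f' i"
      using g'(1) h'(1) eq' f(2) f'(2) that unfolding f(1) f'(1) GL_integral_def
      by (auto intro: exponents_le)
  qed
  \<comment> \<open>Agreement below \<open>n\<close> suffices, since \<open>mat_diag n\<close> reads
    only these exponents.\<close>
  then show ?thesis unfolding f(1) f'(1) by (intro eq_matI) (auto simp: mat_diag_def)
qed

theorem theorem2p1: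
  fixes \<pi> :: "'a::idom" and n :: nat
  assumes "discrete_valuation_ring (ring_of_type_algebra :: 'a ring)"
    and "uniformiser (ring_of_type_algebra :: 'a ring) \<pi>"
    and "n \<ge> 1"
  shows "(GL n :: 'a fract mat set) = (\<Union>t\<in>T_minus n \<pi>. double_coset (GL_integral n) t)
    \<and> disjoint_family_on (double_coset (GL_integral n)) (T_minus n \<pi>)"
proof
  interpret dvr_uniformiser \<pi> using assms(1,2) by (rule dvr_uniformiserI)
  have T_GL: "T_minus n \<pi> \<subseteq> GL n" using uniformiser_nonzero by (rule T_minus_subset_GL)
  show "(GL n :: 'a fract mat set) = (\<Union>t\<in>T_minus n \<pi>. double_coset (GL_integral n) t)"
  proof
    show "(GL n :: 'a fract mat set) \<subseteq> (\<Union>t\<in>T_minus n \<pi>. double_coset (GL_integral n) t)"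
      using GL_fract_decomposition unfolding double_coset_def by blast
    show "(\<Union>t\<in>T_minus n \<pi>. double_coset (GL_integral n) t) \<subseteq> (GL n :: 'a fract mat set)"
      using GL_integral_subset T_GL unfolding double_coset_def by (blast intro: GL_mult)
  qed
  show "disjoint_family_on (double_coset (GL_integral n)) (T_minus n \<pi>)"
    unfolding disjoint_family_on_def
  proof (intro ballI impI, rule ccontr)
    fix t t' assume t: "t \<in> T_minus n \<pi>" and t': "t' \<in> T_minus n \<pi>" and "t \<noteq> t'"
    assume "double_coset (GL_integral n) t \<inter> double_coset (GL_integral n) t' \<noteq> {}"
    then obtain g h g' h' where gh: "g \<in> GL_integral n" "h \<in> GL_integral n"
        "g' \<in> GL_integral n" "h' \<in> GL_integral n" and eq: "g * t * h = g' * t' * h'"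
      unfolding double_coset_def by blast
    \<comment> \<open>Inverting \<open>g'\<close> on the left and \<open>h\<close> on the right
      turns the common element into the relation \<open>a * g * t = t' * (h' * b)\<close>, the form
      that \<open>T_minus_eqI\<close> takes.\<close>
    obtain a where a: "a \<in> GL_integral n" "a * g' = 1\<^sub>m n" using GL_integral_inverse[OF gh(3)] by metis
    obtain b where b: "b \<in> GL_integral n" "h * b = 1\<^sub>m n" using GL_integral_inverse[OF gh(2)] by metis
    have carrier: "t \<in> carrier_mat n n" "t' \<in> carrier_mat n n"
      using t t' T_GL GL_carrier by blast+
    note carrier = carrier gh[THEN GL_integral_carrier]
      a(1)[THEN GL_integral_carrier] b(1)[THEN GL_integral_carrier]
    have "a * g * t = a * g * t * (h * b)" using carrier by (simp add: b(2))
    also have "\<dots> = a * (g * t * h) * b" using carrier by (intro mult_mat_regroup[symmetric])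
    also have "\<dots> = (a * g') * t' * (h' * b)"
      unfolding eq using carrier by (intro mult_mat_regroup)
    also have "\<dots> = t' * (h' * b)" using carrier by (simp add: a(2))
    finally have "t = t'"
      using T_minus_eqI[OF t t'] GL_integral_mult a(1) b(1) gh by blast
    with \<open>t \<noteq> t'\<close> show False ..
  qed
qed

end
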